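(* Let $\{u_\epsilon\}_{\epsilon>0}$ be a family such that each $u_\epsilon$ is a solution of $$-\epsilon(\phi_p(\epsilon u'))'+a(x)W'(u)=0\ \text{ on }[0,1],\qquad u'(0)=0=u'(1),$$ and define the energy $$E_\epsilon(x)=-\frac{1}{a(x)}\mathcal L(\epsilon u_\epsilon'(x))+W(u_\epsilon(x)),\qquad x\in[0,1].$$ Then, for every $\epsilon>0$, $$E_\epsilon'(x)=\frac{a'(x)}{a(x)^2}\,\mathcal L(\epsilon u_\epsilon'(x)),\qquad \forall\, x\in[0,1].$$ Moreover, up to subsequences, $E_\epsilon$ converges uniformly on $[0,1]$ as $\epsilon\to0^+$; that is, every sequence $\epsilon_n\to0^+$ has a subsequence along which $E_{\epsilon_n}\to E$ uniformly on $[0,1]$ for some function $E:[0,1]\to\mathbb R$.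
   Context: Fix $p>1$, $\phi_p(s)=|s|^{p-2}s$ (with $\phi_p(0)=0$), $p^*=p/(p-1)$, $\mathcal L(s)=\frac{1}{p^*}|s|^p$ for $s\in\mathbb R$. The weight $a\in C^1([0,1])$ satisfies $a(x)>0$ for all $x\in[0,1]$. The potential $W:[-1,1]\to\mathbb R$ is of class $C^1$ and satisfies: (W1) there are constants $C_{-1},C_0,C_1,W_0>0$ with $W(u)=\frac{C_{\pm1}}{p}|u-(\pm1)|^p+o(|u-(\pm1)|^p)$ as $u\to\pm1$, and $W(u)=W_0-\frac{C_0}{p}|u|^p+o(|u|^p)$ as $u\to0$; (W2) the function $u\mapsto W'(u)/\phi_p(u)$ on $[-1,1]\setminus\{0\}$ is strictly decreasing on $[-1,0)$ and strictly increasing on $(0,1]$. A solution of the boundary value problem is a function $u\in C^1([0,1])$ with values in $[-1,1]$, with $u'(0)=u'(1)=0$, such that $\phi_p(u')\in C^1([0,1])$ and the equation holds for every $x\in[0,1]$. *)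

theory Defs
  imports "HOL-Analysis.Analysis" "HOL-Library.Landau_Symbols"
begin

text \<open>
  Derivatives are taken relative to the compact interval on which the function lives, hence are
  one-sided at its endpoints. The value of \<open>deriv_within S f x\<close> is only meaningful where \<open>f\<close> is
  differentiable at \<open>x\<close> within \<open>S\<close>.
\<close>

definition deriv_within :: "real set \<Rightarrow> (real \<Rightarrow> real) \<Rightarrow> real \<Rightarrow> real" where
  "deriv_within S f x = vector_derivative f (at x within S)"

definition C1_on :: "real set \<Rightarrow> (real \<Rightarrow> real) \<Rightarrow> bool" where
  "C1_on S f \<longleftrightarrow>
     (\<forall>x\<in>S. f differentiable (at x within S)) \<and> continuous_on S (deriv_within S f)"

text \<open>Since \<open>0 powr c = 0\<close> for every \<open>c\<close>, the following two functions vanish at \<open>0\<close> for all \<open>p\<close>.\<close>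

definition phi :: "real \<Rightarrow> real \<Rightarrow> real" where
  "phi p s = \<bar>s\<bar> powr (p - 2) * s"

definition conj_exponent :: "real \<Rightarrow> real" where
  "conj_exponent p = p / (p - 1)"

definition L_p :: "real \<Rightarrow> real \<Rightarrow> real" where
  "L_p p s = 1 / conj_exponent p * \<bar>s\<bar> powr p"

text \<open>The expansions at \<open>1\<close> and \<open>-1\<close> are one-sided because \<open>W\<close> is defined on \<open>[-1,1]\<close> only.
  The filters omit the base points themselves; for continuous \<open>W\<close> the expansions force
  \<open>W (-1) = W 1 = 0\<close> and \<open>W 0 = W0\<close>.\<close>

definition W1 :: "real \<Rightarrow> (real \<Rightarrow> real) \<Rightarrow> bool" where
  "W1 p W \<longleftrightarrow> (\<exists>Cm C0 Cp W0. Cm > 0 \<and> C0 > 0 \<and> Cp > 0 \<and> W0 > 0 \<and>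
     (\<lambda>s. W s - Cm / p * \<bar>s - (-1)\<bar> powr p)
       \<in> o[at (-1) within {-1..1}](\<lambda>s. \<bar>s - (-1)\<bar> powr p) \<and>
     (\<lambda>s. W s - Cp / p * \<bar>s - 1\<bar> powr p)
       \<in> o[at 1 within {-1..1}](\<lambda>s. \<bar>s - 1\<bar> powr p) \<and>
     (\<lambda>s. W s - (W0 - C0 / p * \<bar>s\<bar> powr p))
       \<in> o[at 0 within {-1..1}](\<lambda>s. \<bar>s\<bar> powr p))"

definition W2 :: "real \<Rightarrow> (real \<Rightarrow> real) \<Rightarrow> bool" where
  "W2 p W \<longleftrightarrow>
     strict_antimono_on {-1..<0} (\<lambda>s. deriv_within {-1..1} W s / phi p s) \<and>
     strict_mono_on {0<..1} (\<lambda>s. deriv_within {-1..1} W s / phi p s)"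

definition is_solution ::
  "real \<Rightarrow> (real \<Rightarrow> real) \<Rightarrow> (real \<Rightarrow> real) \<Rightarrow> real \<Rightarrow> (real \<Rightarrow> real) \<Rightarrow> bool" where
  "is_solution p a W \<epsilon> u \<longleftrightarrow>
     C1_on {0..1} u \<and>
     (\<forall>x\<in>{0..1}. u x \<in> {-1..1}) \<and>
     deriv_within {0..1} u 0 = 0 \<and> deriv_within {0..1} u 1 = 0 \<and>
     C1_on {0..1} (\<lambda>y. phi p (deriv_within {0..1} u y)) \<and>
     (\<forall>x\<in>{0..1}.
        - \<epsilon> * deriv_within {0..1} (\<lambda>y. phi p (\<epsilon> * deriv_within {0..1} u y)) x
          + a x * deriv_within {-1..1} W (u x) = 0)"

definition energy ::
  "real \<Rightarrow> (real \<Rightarrow> real) \<Rightarrow> (real \<Rightarrow> real) \<Rightarrow> real \<Rightarrow> (real \<Rightarrow> real) \<Rightarrow> real \<Rightarrow> real" where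
  "energy p a W \<epsilon> u x = - (1 / a x) * L_p p (\<epsilon> * deriv_within {0..1} u x) + W (u x)"

end

theory Submission
  imports Defs "HOL-Complex_Analysis.Great_Picard"
begin

text \<open>
  Put \<open>q = phi p (\<epsilon> u')\<close>. The map \<open>phi p\<close> is inverted by \<open>phi (conj_exponent p)\<close>, which is
  the derivative of \<open>s \<mapsto> \<bar>s\<bar> powr p* / p*\<close> with \<open>p* = conj_exponent p\<close>. The kinetic term
  \<open>L_p p (\<epsilon> u')\<close> equals \<open>\<bar>q\<bar> powr p* / p*\<close>, so it is differentiable although \<open>u'\<close> need
  not be, and its derivative is \<open>\<epsilon> u' q'\<close>. The equation \<open>\<epsilon> q' = a W'(u)\<close> then turns this
  derivative into \<open>a W'(u) u'\<close>, which cancels the derivative of \<open>W(u)\<close> in the energy and leaves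
  only the term that comes from the variation of \<open>a\<close>.

  That formula still contains \<open>\<epsilon> u'\<close>, whose size is not known in advance. Eliminating the
  kinetic term in favour of the energy shows \<open>(a E)' = a' W(u)\<close>, and the right-hand side is
  bounded independently of \<open>\<epsilon>\<close> because \<open>u\<close> takes values in \<open>[-1,1]\<close>. By the Neumann
  condition \<open>a E\<close> equals \<open>a W(u)\<close> at \<open>0\<close>, hence \<open>E\<close> is bounded uniformly in \<open>\<epsilon>\<close>. Going back,
  \<open>E' = (a'/a) (W(u) - E)\<close> is bounded too, so the energies are uniformly bounded and uniformly
  Lipschitz, and the theorem of Arzela and Ascoli applies.
\<close>

section \<open>Derivatives relative to an interval\<close>

lemma C1_on_has_derivative:
  assumes "C1_on S f" "x \<in> S"
  shows "(f has_real_derivative deriv_within S f x) (at x within S)"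
  using assms
  by (simp add: C1_on_def deriv_within_def has_real_derivative_iff_has_vector_derivative
      flip: vector_derivative_works)

lemma C1_on_continuous:
  assumes "C1_on S f"
  shows "continuous_on S f"
  using assms unfolding C1_on_def
  by (simp add: differentiable_imp_continuous_within continuous_on_eq_continuous_within)

lemma deriv_within_eqI:
  assumes "(f has_real_derivative D) (at x within {a..b})" "a < b" "x \<in> {a..b}"
  shows "deriv_within {a..b} f x = D"
  using assms unfolding deriv_within_def
  by (intro vector_derivative_within_closed_interval)
     (auto simp: has_real_derivative_iff_has_vector_derivative)

lemma continuous_on_compact_bounded:
  fixes f :: "'a::topological_space \<Rightarrow> real"
  assumes "continuous_on S f" "compact S"
  obtains B where "\<And>x. x \<in> S \<Longrightarrow> \<bar>f x\<bar> \<le> B"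
  using compact_imp_bounded[OF compact_continuous_image[OF assms]]
  by (auto simp: bounded_iff)

section \<open>The functions \<open>phi\<close> and \<open>L_p\<close>\<close>

text \<open>
  Away from \<open>0\<close> this is the power rule on each half-line. At \<open>0\<close> the difference quotient has
  size \<open>\<bar>y\<bar> powr (r - 1) / r\<close>, which tends to \<open>0\<close> because \<open>r > 1\<close>.
\<close>

lemma has_derivative_abs_powr:
  fixes r s :: real
  assumes "r > 1"
  shows "((\<lambda>s. \<bar>s\<bar> powr r / r) has_real_derivative phi r s) (at s)"
proof (cases "s = 0")
  case True
  have "((\<lambda>y. \<bar>y\<bar> powr (r - 1) / r) \<longlongrightarrow> \<bar>0\<bar> powr (r - 1) / r) (at 0)"
    using assms by (intro tendsto_intros) auto
  then have "((\<lambda>y. \<bar>y\<bar> powr (r - 1) / r) \<longlongrightarrow> 0) (at (0::real))" by simp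
  moreover have "norm (\<bar>y\<bar> powr r / r / y) \<le> \<bar>y\<bar> powr (r - 1) / r" for y :: real
    using assms by (cases "y = 0") (auto simp: powr_diff abs_mult mult.commute)
  ultimately have "((\<lambda>y. \<bar>y\<bar> powr r / r / y) \<longlongrightarrow> 0) (at (0::real))"
    by (intro Lim_null_comparison[of "\<lambda>y. \<bar>y\<bar> powr r / r / y"]) auto
  then show ?thesis using True assms by (simp add: has_field_derivative_iff phi_def)
next
  case False
  have pos: "((\<lambda>s. s powr r / r) has_real_derivative t powr (r - 1)) (at t)" if "t > 0" for t
    using that assms by (auto intro!: derivative_eq_intros)
  have powr: "t powr (r - 1) = t powr (r - 2) * t" if "t > 0" for t :: real
    using that by (simp add: powr_diff power2_eq_square)
  show ?thesis
  proof (cases "s > 0")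
    case True
    have "((\<lambda>s. \<bar>s\<bar> powr r / r) has_real_derivative s powr (r - 1)) (at s)"
      by (rule has_field_derivative_transform_within_open[OF pos[OF True], of "{0<..}"])
         (use True in auto)
    with True show ?thesis by (simp add: phi_def powr)
  next
    case neg: False
    with False have s: "- s > 0" by simp
    have "((\<lambda>s. (- s) powr r / r) has_real_derivative (- s) powr (r - 1) * - 1) (at s)"
      by (rule DERIV_chain2[where f = "\<lambda>t. t powr r / r" and g = uminus, OF pos[OF s]])
         (auto intro!: derivative_eq_intros)
    then have "((\<lambda>s. \<bar>s\<bar> powr r / r) has_real_derivative (- s) powr (r - 1) * - 1) (at s)"
      by (rule has_field_derivative_transform_within_open[of _ _ _ "{..<0}"]) (use s in auto)
    with s show ?thesis by (simp add: phi_def powr[OF s])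
  qed
qed

lemma conj_exponent_gt_1:
  assumes "p > 1"
  shows "conj_exponent p > 1"
  using assms by (simp add: conj_exponent_def)

lemma abs_phi: "\<bar>phi p s\<bar> = \<bar>s\<bar> powr (p - 1)"
  by (cases "s = 0") (simp_all add: phi_def abs_mult powr_diff power2_eq_square)

lemma phi_mult:
  assumes "c > 0"
  shows "phi p (c * s) = c powr (p - 1) * phi p s"
  using assms by (simp add: phi_def abs_mult powr_mult powr_diff power2_eq_square)

lemma phi_conj_phi:
  assumes "p > 1"
  shows "phi (conj_exponent p) (phi p s) = s"
proof (cases "s = 0")
  case False
  have "(p - 1) * (conj_exponent p - 2) = 2 - p"
    using assms by (simp add: conj_exponent_def field_simps)
  then have "phi (conj_exponent p) (phi p s) = \<bar>s\<bar> powr (2 - p) * (\<bar>s\<bar> powr (p - 2) * s)"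
    by (subst phi_def) (simp add: abs_phi powr_powr, simp add: phi_def)
  also have "\<dots> = \<bar>s\<bar> powr ((2 - p) + (p - 2)) * s"
    by (simp only: powr_add mult.assoc)
  finally show ?thesis using False by simp
qed (simp add: phi_def)

lemma L_p_eq_phi:
  assumes "p > 1"
  shows "L_p p s = \<bar>phi p s\<bar> powr conj_exponent p / conj_exponent p"
  using assms by (simp add: L_p_def abs_phi powr_powr conj_exponent_def)

text \<open>The chain rule through \<open>phi p\<close>: only \<open>phi p \<circ> v\<close>, and not \<open>v\<close>, has to be differentiable.\<close>

lemma has_derivative_L_p:
  assumes "p > 1" and "((\<lambda>x. phi p (v x)) has_real_derivative D) (at x within S)"
  shows "((\<lambda>x. L_p p (v x)) has_real_derivative v x * D) (at x within S)"
  using DERIV_chain2[OF has_derivative_abs_powr[OF conj_exponent_gt_1[OF assms(1)]] assms(2)]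
  by (simp add: L_p_eq_phi[OF assms(1)] phi_conj_phi[OF assms(1)])

section \<open>The energy along a solution\<close>

lemma energy_has_derivative:
  assumes "p > 1" and a: "C1_on {0..1} a" and apos: "\<forall>x\<in>{0..1}. a x > 0"
    and W: "C1_on {-1..1} W" and sol: "is_solution p a W \<epsilon> u" and "\<epsilon> > 0"
    and x: "x \<in> {0..1}"
  shows "(energy p a W \<epsilon> u has_real_derivative
           deriv_within {0..1} a x / (a x)\<^sup>2 * L_p p (\<epsilon> * deriv_within {0..1} u x))
         (at x within {0..1})"
proof -
  define v where "v = (\<lambda>y. \<epsilon> * deriv_within {0..1} u y)"
  define w where "w = deriv_within {-1..1} W (u x)"
  have ax: "a x > 0" using apos x by blast
  have u: "C1_on {0..1} u" and uW: "u ` {0..1} \<subseteq> {-1..1}"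
    and phiu: "C1_on {0..1} (\<lambda>y. phi p (deriv_within {0..1} u y))"
    and eq: "- \<epsilon> * deriv_within {0..1} (\<lambda>y. phi p (v y)) x + a x * w = 0"
    using sol x unfolding is_solution_def v_def w_def by blast+
  \<comment> \<open>The solution concept asserts differentiability of \<open>phi p (u')\<close>; homogeneity of \<open>phi p\<close>
    transfers it to \<open>phi p (\<epsilon> u')\<close>, which is the function in the equation.\<close>
  obtain D where D: "((\<lambda>y. phi p (v y)) has_real_derivative D) (at x within {0..1})"
    using DERIV_cmult[OF C1_on_has_derivative[OF phiu x], of "\<epsilon> powr (p - 1)"]
    unfolding v_def phi_mult[OF \<open>\<epsilon> > 0\<close>] by blast
  have "\<epsilon> * D = a x * w"
    using eq deriv_within_eqI[OF D _ x] by simp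
  then have D_eq: "v x * D = a x * (w * deriv_within {0..1} u x)"
    by (simp add: v_def algebra_simps)
  have L: "((\<lambda>y. L_p p (v y)) has_real_derivative v x * D) (at x within {0..1})"
    by (rule has_derivative_L_p[OF \<open>p > 1\<close> D])
  have "(W has_real_derivative w) (at (u x) within u ` {0..1})"
    unfolding w_def using uW x
    by (intro has_field_derivative_subset[OF C1_on_has_derivative[OF W] uW]) blast
  then have Wu: "((\<lambda>y. W (u y)) has_real_derivative w * deriv_within {0..1} u x)
      (at x within {0..1})"
    using DERIV_image_chain[OF _ C1_on_has_derivative[OF u x]] by (simp add: o_def)
  have a_inv: "((\<lambda>y. 1 / a y) has_real_derivative - deriv_within {0..1} a x / (a x)\<^sup>2)
      (at x within {0..1})"
    by (rule DERIV_cong[OF DERIV_divide[OF DERIV_const C1_on_has_derivative[OF a x]]])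
       (use ax in \<open>simp_all add: power2_eq_square\<close>)
  have "((\<lambda>y. - (1 / a y) * L_p p (v y) + W (u y)) has_real_derivative
      deriv_within {0..1} a x / (a x)\<^sup>2 * L_p p (v x)) (at x within {0..1})"
    by (rule DERIV_cong[OF DERIV_add[OF DERIV_mult[OF DERIV_minus[OF a_inv] L] Wu]])
       (use ax in \<open>simp add: D_eq\<close>)
  then show ?thesis by (simp add: energy_def[abs_def] v_def)
qed

text \<open>
  Multiplying by \<open>a\<close> removes the kinetic term from the derivative, and what remains is controlled
  by the range of \<open>u\<close> alone. The bounds therefore depend neither on \<open>\<epsilon>\<close> nor on the
  solution, which is what compactness of the family needs.
\<close>

lemma energy_uniform_bounds:
  assumes "p > 1" and a: "C1_on {0..1} a" and apos: "\<forall>x\<in>{0..1}. a x > 0"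
    and W: "C1_on {-1..1} W"
  obtains M K where
    "\<And>\<epsilon> u x. \<lbrakk>\<epsilon> > 0; is_solution p a W \<epsilon> u; x \<in> {0..1}\<rbrakk> \<Longrightarrow> \<bar>energy p a W \<epsilon> u x\<bar> \<le> M"
    "\<And>\<epsilon> u x y. \<lbrakk>\<epsilon> > 0; is_solution p a W \<epsilon> u; x \<in> {0..1}; y \<in> {0..1}\<rbrakk>
      \<Longrightarrow> \<bar>energy p a W \<epsilon> u x - energy p a W \<epsilon> u y\<bar> \<le> K * \<bar>x - y\<bar>"
proof -
  obtain A where A: "\<And>x. x \<in> {0..1} \<Longrightarrow> \<bar>deriv_within {0..1} a x\<bar> \<le> A"
    using continuous_on_compact_bounded[of "{0..1}" "deriv_within {0..1} a"] a
    by (auto simp: C1_on_def)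
  obtain B where B: "\<And>s. s \<in> {-1..1} \<Longrightarrow> \<bar>W s\<bar> \<le> B"
    using continuous_on_compact_bounded[OF C1_on_continuous[OF W]] by auto
  obtain x0 where x0: "x0 \<in> {0..1}" "\<And>x. x \<in> {0..1} \<Longrightarrow> a x0 \<le> a x"
    using continuous_attains_inf[OF _ _ C1_on_continuous[OF a]] by auto
  define m where "m = a x0"
  have m: "m > 0" "\<And>x. x \<in> {0..1} \<Longrightarrow> m \<le> a x" using x0 apos by (auto simp: m_def)
  have "A \<ge> 0" "B \<ge> 0" using A[of 0] B[of 0] by auto
  define M where "M = (a 0 * B + A * B) / m"
  define K where "K = A / m * (B + M)"
  have bound: "\<bar>energy p a W \<epsilon> u x\<bar> \<le> M"
    and deriv: "\<bar>deriv_within {0..1} a x / (a x)\<^sup>2 * L_p p (\<epsilon> * deriv_within {0..1} u x)\<bar> \<le> K"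
    if e: "\<epsilon> > 0" and sol: "is_solution p a W \<epsilon> u" and x: "x \<in> {0..1}" for \<epsilon> u x
  proof -
    let ?E = "energy p a W \<epsilon> u"
    let ?L = "\<lambda>y. L_p p (\<epsilon> * deriv_within {0..1} u y)"
    have Wu: "\<bar>W (u y)\<bar> \<le> B" if "y \<in> {0..1}" for y
      using sol that by (intro B) (auto simp: is_solution_def)
    have E': "(?E has_real_derivative deriv_within {0..1} a y / (a y)\<^sup>2 * ?L y)
        (at y within {0..1})" if "y \<in> {0..1}" for y
      using energy_has_derivative[OF \<open>p > 1\<close> a apos W sol e that] .
    have L: "?L y = a y * (W (u y) - ?E y)" if "y \<in> {0..1}" for y
      using apos that by (force simp: energy_def field_simps)
    have aE: "((\<lambda>y. a y * ?E y) has_real_derivative deriv_within {0..1} a y * W (u y))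
        (at y within {0..1})" if y: "y \<in> {0..1}" for y
    proof -
      have "a y > 0" using apos y by blast
      then show ?thesis
        by (intro DERIV_cong[OF DERIV_mult[OF C1_on_has_derivative[OF a y] E'[OF y]]])
           (simp add: L[OF y] power2_eq_square field_simps)
    qed
    have "norm (a x * ?E x - a 0 * ?E 0) \<le> A * B * norm (x - 0)"
      by (rule field_differentiable_bound[OF convex_real_interval(5) aE])
         (use x A Wu \<open>A \<ge> 0\<close> in \<open>auto simp: abs_mult intro!: mult_mono\<close>)
    also have "\<dots> \<le> A * B" using x \<open>A \<ge> 0\<close> \<open>B \<ge> 0\<close> by (simp add: mult_left_le)
    finally have 1: "\<bar>a x * ?E x - a 0 * ?E 0\<bar> \<le> A * B" by simp
    \<comment> \<open>The Neumann condition makes the kinetic term vanish at the left endpoint.\<close>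
    have "?E 0 = W (u 0)" using sol by (simp add: energy_def is_solution_def L_p_def)
    then have 2: "\<bar>a 0 * ?E 0\<bar> \<le> a 0 * B"
      using Wu[of 0] apos by (simp add: abs_mult less_imp_le mult_left_mono)
    have "m * \<bar>?E x\<bar> \<le> \<bar>a x * ?E x\<bar>"
      using m(1) m(2)[OF x] by (simp add: abs_mult mult_right_mono)
    with 1 2 have "m * \<bar>?E x\<bar> \<le> a 0 * B + A * B" by linarith
    then show bd: "\<bar>?E x\<bar> \<le> M" using m(1) by (simp add: M_def field_simps)
    have ax: "a x > 0" using apos x by blast
    have "\<bar>deriv_within {0..1} a x / (a x)\<^sup>2 * ?L x\<bar>
        = \<bar>deriv_within {0..1} a x\<bar> / a x * \<bar>W (u x) - ?E x\<bar>"
      using ax by (simp add: L[OF x] abs_mult power2_eq_square)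
    also have "\<dots> \<le> K"
      unfolding K_def using A[OF x] m(1) m(2)[OF x] Wu[OF x] bd \<open>A \<ge> 0\<close>
      by (intro mult_mono frac_le) auto
    finally show "\<bar>deriv_within {0..1} a x / (a x)\<^sup>2 * ?L x\<bar> \<le> K" .
  qed
  have "\<bar>energy p a W \<epsilon> u x - energy p a W \<epsilon> u y\<bar> \<le> K * \<bar>x - y\<bar>"
    if sol: "\<epsilon> > 0" "is_solution p a W \<epsilon> u" and xy: "x \<in> {0..1}" "y \<in> {0..1}" for \<epsilon> u x y
    using field_differentiable_bound[OF convex_real_interval(5)
        energy_has_derivative[OF \<open>p > 1\<close> a apos W sol(2,1)]] deriv[OF sol] xy
    unfolding real_norm_def by blast
  with bound that show thesis by blast
qed

section \<open>Compactness\<close>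

lemma uniformly_Lipschitz_imp_uniform_limit_subseq:
  fixes F :: "nat \<Rightarrow> real \<Rightarrow> real"
  assumes "compact S" and bound: "\<And>n x. x \<in> S \<Longrightarrow> \<bar>F n x\<bar> \<le> M"
    and lip: "\<And>n x y. \<lbrakk>x \<in> S; y \<in> S\<rbrakk> \<Longrightarrow> \<bar>F n x - F n y\<bar> \<le> K * \<bar>x - y\<bar>"
  obtains r g where "strict_mono (r :: nat \<Rightarrow> nat)" "uniform_limit S (\<lambda>n. F (r n)) g sequentially"
proof -
  have equicont: "\<exists>d>0. \<forall>n y. y \<in> S \<and> norm (x - y) < d \<longrightarrow> norm (F n x - F n y) < e"
    if x: "x \<in> S" and e: "0 < e" for x and e :: real
    \<comment> \<open>\<open>\<bar>K\<bar> + 1\<close> replaces \<open>K\<close> as a denominator because \<open>K\<close> may be \<open>0\<close>.\<close>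
  proof (intro exI[of _ "e / (\<bar>K\<bar> + 1)"] conjI allI impI)
    fix n y assume y: "y \<in> S \<and> norm (x - y) < e / (\<bar>K\<bar> + 1)"
    have "\<bar>F n x - F n y\<bar> \<le> K * \<bar>x - y\<bar>" using lip x y by blast
    also have "\<dots> \<le> (\<bar>K\<bar> + 1) * \<bar>x - y\<bar>" by (intro mult_right_mono) auto
    also have "\<dots> < e" using y by (simp add: field_simps)
    finally show "norm (F n x - F n y) < e" by simp
  qed (use e in auto)
  obtain g r where r: "strict_mono (r :: nat \<Rightarrow> nat)"
    and g: "\<And>e. 0 < e \<Longrightarrow> \<exists>N. \<forall>n x. n \<ge> N \<and> x \<in> S \<longrightarrow> norm (F (r n) x - g x) < e"
  proof (rule Arzela_Ascoli[OF \<open>compact S\<close>, of F M])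
    show "norm (F n x) \<le> M" if "x \<in> S" for n x using bound[OF that] by simp
  qed (use equicont in blast)+
  have "uniform_limit S (\<lambda>n. F (r n)) g sequentially"
    unfolding uniform_limit_iff eventually_sequentially dist_norm using g by blast
  with r that show thesis by blast
qed

theorem proposition3p3:
  fixes p :: real and a W :: "real \<Rightarrow> real" and u :: "real \<Rightarrow> real \<Rightarrow> real"
  assumes "p > 1"
    and "C1_on {0..1} a" and "\<forall>x\<in>{0..1}. a x > 0"
    and "C1_on {-1..1} W" and "W1 p W" and "W2 p W"
    and "\<forall>\<epsilon>>0. is_solution p a W \<epsilon> (u \<epsilon>)"
  shows "(\<forall>\<epsilon>>0. \<forall>x\<in>{0..1}.
            (energy p a W \<epsilon> (u \<epsilon>) has_real_derivative
               deriv_within {0..1} a x / (a x)\<^sup>2 * L_p p (\<epsilon> * deriv_within {0..1} (u \<epsilon>) x))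
            (at x within {0..1})) \<and>
         (\<forall>e :: nat \<Rightarrow> real. (\<forall>n. e n > 0) \<and> e \<longlonglongrightarrow> 0 \<longrightarrow>
            (\<exists>(r :: nat \<Rightarrow> nat) (E :: real \<Rightarrow> real). strict_mono r \<and>
               uniform_limit {0..1} (\<lambda>n. energy p a W (e (r n)) (u (e (r n)))) E sequentially))"
proof (intro conjI allI ballI impI)
  fix \<epsilon> x :: real assume "\<epsilon> > 0" "x \<in> {0..1}"
  then show "(energy p a W \<epsilon> (u \<epsilon>) has_real_derivative
      deriv_within {0..1} a x / (a x)\<^sup>2 * L_p p (\<epsilon> * deriv_within {0..1} (u \<epsilon>) x))
      (at x within {0..1})"
    using assms by (intro energy_has_derivative) auto
next
  fix e :: "nat \<Rightarrow> real" assume "(\<forall>n. e n > 0) \<and> e \<longlonglongrightarrow> 0"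
  then have e: "e n > 0" for n by blast
  obtain M K where
    bound: "\<And>\<epsilon> u x. \<lbrakk>\<epsilon> > 0; is_solution p a W \<epsilon> u; x \<in> {0..1}\<rbrakk> \<Longrightarrow> \<bar>energy p a W \<epsilon> u x\<bar> \<le> M"
    and lip: "\<And>\<epsilon> u x y. \<lbrakk>\<epsilon> > 0; is_solution p a W \<epsilon> u; x \<in> {0..1}; y \<in> {0..1}\<rbrakk>
      \<Longrightarrow> \<bar>energy p a W \<epsilon> u x - energy p a W \<epsilon> u y\<bar> \<le> K * \<bar>x - y\<bar>"
    using energy_uniform_bounds[OF assms(1-4)] by blast
  have sol: "is_solution p a W (e n) (u (e n))" for n using assms(7) e by blast
  show "\<exists>(r :: nat \<Rightarrow> nat) (E :: real \<Rightarrow> real). strict_mono r \<and>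
      uniform_limit {0..1} (\<lambda>n. energy p a W (e (r n)) (u (e (r n)))) E sequentially"
    by (rule uniformly_Lipschitz_imp_uniform_limit_subseq
        [of "{0..1}" "\<lambda>n. energy p a W (e n) (u (e n))",
          OF compact_Icc bound[OF e sol] lip[OF e sol]]) blast+
qed

end
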